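(* Fix integers $a\ge b\ge r> t>0$ and $n$, and let $\mathcal A\subset\binom{[n]}{a}$ and $\mathcal B\subset\binom{[n]}{b}$ be shifted families that are cross $t$-intersecting. Put $j:=2r-t-1$. If $n\ge 2a$, then there exist $j$-juntas $\mathcal J$ and $\mathcal I$, both with center $[j]$, which are cross $t$-intersecting and satisfy $$|\mathcal A\setminus \mathcal J|\le 2^j\binom{n-j}{a-r}\quad\text{and}\quad |\mathcal B\setminus \mathcal I|\le 2^j\binom{n-j}{b-r}.$$
   Context: $[n]=\{1,\dots,n\}$, $\binom{[n]}{k}$ is the family of $k$-element subsets of $[n]$. A family $\mathcal J\subset 2^{[n]}$ is a $j$-junta if there exist a set $J\in\binom{[n]}{j}$ (the center) and a family $\mathcal J^*\subset 2^J$ (the defining family) such that $\mathcal J=\{F\subset[n]: F\cap J\in\mathcal J^*\}$. Families $\mathcal A,\mathcal B$ are cross $t$-intersecting if $|A\cap B|\ge t$ for all $A\in\mathcal A$, $B\in\mathcal B$. A family $\mathcal F\subset\binom{[n]}{k}$ is shifted if whenever $\{x_1<\dots<x_k\}\in\mathcal F$ and $G=\{y_1<\dots<y_k\}\subset[n]$ with $y_i\le x_i$ for all $i$, then $G\in\mathcal F$. *)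

theory Defs
  imports Main "HOL-Library.Ramsey"
begin

text \<open>The family of all \<open>k\<close>-element subsets of \<open>[n] = {1, \<dots>, n}\<close> is \<open>nsets {1..n} k\<close>.\<close>

definition junta_with_center :: "nat \<Rightarrow> nat \<Rightarrow> nat set \<Rightarrow> nat set set \<Rightarrow> bool" where
  "junta_with_center n j C \<F> \<longleftrightarrow>
     C \<in> nsets {1..n} j \<and>
     (\<exists>\<D>. \<D> \<subseteq> Pow C \<and> \<F> = {F. F \<subseteq> {1..n} \<and> F \<inter> C \<in> \<D>})"

definition cross_intersecting :: "nat \<Rightarrow> 'a set set \<Rightarrow> 'a set set \<Rightarrow> bool" where
  "cross_intersecting t \<A> \<B> \<longleftrightarrow> (\<forall>A\<in>\<A>. \<forall>B\<in>\<B>. t \<le> card (A \<inter> B))"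

text \<open>The increasing enumeration \<open>x\<^sub>1 < \<dots> < x\<^sub>k\<close> of a finite set \<open>X\<close> is \<open>sorted_list_of_set X\<close>,
  indexed from \<open>0\<close>.\<close>

definition shifted :: "nat \<Rightarrow> nat \<Rightarrow> nat set set \<Rightarrow> bool" where
  "shifted n k \<F> \<longleftrightarrow>
     \<F> \<subseteq> nsets {1..n} k \<and>
     (\<forall>X\<in>\<F>. \<forall>G\<in>nsets {1..n} k.
        (\<forall>i<k. sorted_list_of_set G ! i \<le> sorted_list_of_set X ! i) \<longrightarrow> G \<in> \<F>)"

end

theory Submission
  imports Defs "HOL.Binomial_Plus"
begin

text \<open>
  View a set \<open>F\<close> as the lattice path with height \<open>2 |F \<inter> [s]| - s\<close> at time \<open>s\<close>. Shiftedness and the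
  cross \<open>t\<close>-intersecting property force, for all \<open>A \<in> \<A>\<close> and \<open>B \<in> \<B>\<close>, some \<open>s\<close> with
  \<open>|A \<inter> [s]| + |B \<inter> [s]| \<ge> s + t\<close>: otherwise \<open>A\<close> could be shifted down to a set meeting \<open>B\<close> in at
  most \<open>t - 1\<close> elements. The defining families of the juntas consist of the traces on \<open>[j]\<close> of members
  whose path stays below height \<open>t\<close> from time \<open>j\<close> on. For two such members the time \<open>s\<close> above is less
  than \<open>j\<close>, so already the traces share \<open>t\<close> elements. Every member outside the junta reaches height
  \<open>t\<close> at or after time \<open>j\<close>, and by the reflection principle each of the \<open>2 ^ j\<close> traces belongs to at
  most \<open>(n - j) choose (k - r)\<close> such members.
\<close>

section \<open>Shifting in terms of prefix counts\<close>

lemma initial_subset_exists: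
  fixes S :: "'a::linorder set"
  assumes "finite S" "k \<le> card S"
  shows "\<exists>G\<subseteq>S. card G = k \<and> (\<forall>g\<in>G. \<forall>x\<in>S. x < g \<longrightarrow> x \<in> G)"
  using assms(2)
proof (induction k)
  case 0
  show ?case by (rule exI[of _ "{}"]) simp
next
  case (Suc k)
  then obtain G where G: "G \<subseteq> S" "card G = k" "\<forall>g\<in>G. \<forall>x\<in>S. x < g \<longrightarrow> x \<in> G"
    by auto
  have fin: "finite G" using G(1) assms(1) finite_subset by blast
  have ne: "S - G \<noteq> {}" using Suc.prems G by (metis Diff_eq_empty_iff card_mono fin not_less_eq_eq)
  define m where "m = Min (S - G)"
  have m: "m \<in> S - G" unfolding m_def by (rule Min_in) (use assms(1) ne in auto)
  have "x \<in> G" if "x \<in> S" "x < m" for x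
    using that assms(1) unfolding m_def by (meson DiffI Min_le finite_Diff leD)
  then show ?case
    using G m fin by (intro exI[of _ "insert m G"]) auto
qed

lemma card_less_nth_sorted_list_of_set:
  fixes X :: "'a::linorder set"
  assumes "finite X" "i < card X"
  shows "card {y\<in>X. y < sorted_list_of_set X ! i} = i"
proof -
  let ?l = "sorted_list_of_set X"
  have "{y\<in>X. y < ?l ! i} = (!) ?l ` {..<i}"
  proof (intro set_eqI iffI)
    fix y assume y: "y \<in> {y\<in>X. y < ?l ! i}"
    then have "y \<in> set ?l" using assms(1) by simp
    then obtain q where q: "q < card X" "y = ?l ! q"
      using assms(1) by (metis in_set_conv_nth length_sorted_list_of_set)
    then have "q < i"
      using y sorted_nth_mono[OF sorted_sorted_list_of_set, of i q X] by force
    then show "y \<in> (!) ?l ` {..<i}" using q by auto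
  next
    fix y assume "y \<in> (!) ?l ` {..<i}"
    then obtain q where q: "q < i" "y = ?l ! q" by auto
    have "?l ! q < ?l ! i"
      using q assms strict_sorted_list_of_set[of X] by (auto simp: sorted_wrt_nth_less)
    moreover have "?l ! q \<in> X"
      using q assms by (metis less_trans nth_mem length_sorted_list_of_set set_sorted_list_of_set)
    ultimately show "y \<in> {y\<in>X. y < ?l ! i}" using q by auto
  qed
  moreover have "inj_on ((!) ?l) {..<i}"
    using assms by (intro inj_on_nth) auto
  ultimately show ?thesis by (simp add: card_image)
qed

text \<open>If the entry of \<open>G\<close> at index \<open>i\<close> exceeded that of
  \<open>X\<close>, then up to the latter \<open>G\<close> would have at most \<open>i\<close>
  elements while \<open>X\<close> has \<open>Suc i\<close>, since indices start at 0.\<close>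

lemma sorted_list_of_set_nth_le:
  fixes G X :: "'a::linorder set"
  assumes fin: "finite G" "finite X" and card: "card G = card X" and i: "i < card X"
    and dom: "\<And>s. s \<in> X \<Longrightarrow> card (X \<inter> {..s}) \<le> card (G \<inter> {..s})"
  shows "sorted_list_of_set G ! i \<le> sorted_list_of_set X ! i"
proof (rule ccontr)
  let ?x = "sorted_list_of_set X ! i" and ?g = "sorted_list_of_set G ! i"
  assume "\<not> ?g \<le> ?x"
  then have "G \<inter> {..?x} \<subseteq> {y\<in>G. y < ?g}" by auto
  from card_mono[OF _ this] have "card (G \<inter> {..?x}) \<le> i"
    using card_less_nth_sorted_list_of_set[of G i] fin card i by simp
  moreover have x: "?x \<in> X"
    using fin i by (metis nth_mem length_sorted_list_of_set set_sorted_list_of_set)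
  moreover have "X \<inter> {..?x} = insert ?x {y\<in>X. y < ?x}" using x by auto
  then have "card (X \<inter> {..?x}) = Suc i"
    using card_less_nth_sorted_list_of_set[of X i] fin i by simp
  ultimately show False using dom[of ?x] by simp
qed

text \<open>Turns the entrywise order behind shiftedness into prefix counts, so that later arguments
  can compare paths instead of sorted lists.\<close>

lemma shifted_mem_of_dominates:
  assumes "shifted n k \<F>" "X \<in> \<F>" "G \<in> nsets {1..n} k"
    and dom: "\<And>s. s \<le> n \<Longrightarrow> card (X \<inter> {1..s}) \<le> card (G \<inter> {1..s})"
  shows "G \<in> \<F>"
proof -
  have X: "X \<in> nsets {1..n} k" using assms(1,2) unfolding shifted_def by blast
  have "card (X \<inter> {..s}) \<le> card (G \<inter> {..s})" if "s \<in> X" for s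
  proof -
    have "X \<inter> {..s} = X \<inter> {1..s}" "G \<inter> {..s} = G \<inter> {1..s}"
      using X assms(3) unfolding nsets_def by force+
    moreover have "s \<le> n" using that X unfolding nsets_def by force
    ultimately show ?thesis using dom by simp
  qed
  then have "\<forall>i<k. sorted_list_of_set G ! i \<le> sorted_list_of_set X ! i"
    using X assms(3) unfolding nsets_def by (auto intro!: sorted_list_of_set_nth_le)
  then show ?thesis using assms(1-3) unfolding shifted_def by blast
qed

section \<open>The prefix inequality\<close>

lemma shifted_cross_intersecting_prefix:
  assumes "shifted n a \<A>" "\<B> \<subseteq> nsets {1..n} b" "cross_intersecting t \<A> \<B>"
    and "0 < t" "t \<le> a" "a + b \<le> n" and A: "A \<in> \<A>" and B: "B \<in> \<B>"
  shows "\<exists>s\<le>n. s + t \<le> card (A \<inter> {1..s}) + card (B \<inter> {1..s})"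
proof (rule ccontr)
  assume "\<not> ?thesis"
  then have less: "card (A \<inter> {1..s}) + card (B \<inter> {1..s}) < s + t" if "s \<le> n" for s
    using that by force
  have An: "A \<subseteq> {1..n}" "card A = a" using A assms(1) unfolding shifted_def nsets_def by auto
  have Bn: "B \<subseteq> {1..n}" "finite B" "card B = b" using B assms(2) unfolding nsets_def by auto
  \<comment> \<open>The target of the shift is \<open>G \<union> T\<close>: \<open>G\<close> is the
    first \<open>a + 1 - t\<close> elements outside \<open>B\<close>, and \<open>T\<close> the first
    \<open>t - 1\<close> elements outside \<open>G\<close>. The sizes add up to \<open>a\<close>,
    and only \<open>T\<close> can meet \<open>B\<close>.\<close>
  define S where "S = {1..n} - B"
  have "card S = n - b" unfolding S_def using Bn by (simp add: card_Diff_subset)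
  then have "a + 1 - t \<le> card S" using assms by linarith
  then obtain G where G: "G \<subseteq> S" "card G = a + 1 - t" "\<forall>g\<in>G. \<forall>x\<in>S. x < g \<longrightarrow> x \<in> G"
    using initial_subset_exists[of S "a + 1 - t"] unfolding S_def by auto
  have finG: "finite G" and Gn: "G \<subseteq> {1..n}"
    using G(1) unfolding S_def by (auto intro: finite_subset)
  have "card ({1..n} - G) = n - (a + 1 - t)" using G finG Gn by (simp add: card_Diff_subset)
  then have "t - 1 \<le> card ({1..n} - G)" using assms by linarith
  then obtain T where T: "T \<subseteq> {1..n} - G" "card T = t - 1"
      "\<forall>g\<in>T. \<forall>x\<in>{1..n} - G. x < g \<longrightarrow> x \<in> T"
    using initial_subset_exists[of "{1..n} - G" "t - 1"] by auto
  have finT: "finite T" using T(1) finite_subset by blast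
  have disj: "G \<inter> T = {}" using T(1) by blast
  have cardGT: "card (G \<union> T) = a"
    using card_Un_disjoint[OF finG finT disj] G T assms by simp
  have "card (A \<inter> {1..s}) \<le> card ((G \<union> T) \<inter> {1..s})" if s: "s \<le> n" for s
  proof (cases "T \<subseteq> {1..s}")
    \<comment> \<open>If \<open>T\<close> extends beyond \<open>s\<close>, it has used up every
      element of \<open>{1..s}\<close> missing from \<open>G\<close>, so the prefix is full.\<close>
    case False
    then obtain q where q: "q \<in> T" "s < q" using T(1) by fastforce
    have "x \<in> G \<union> T" if "x \<in> {1..s}" for x
      using T(3)[rule_format, OF q(1), of x] that q(2) s by auto
    then have "{1..s} \<subseteq> (G \<union> T) \<inter> {1..s}" by blast
    then have "card (A \<inter> {1..s}) \<le> card {1..s} \<and> card {1..s} \<le> card ((G \<union> T) \<inter> {1..s})"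
      by (meson card_mono finite_Int finite_atLeastAtMost inf_le2)
    then show ?thesis by linarith
  next
    case TS: True
    show ?thesis
    proof (cases "G \<subseteq> {1..s}")
      case True
      then have "(G \<union> T) \<inter> {1..s} = G \<union> T" using TS by blast
      moreover have "card (A \<inter> {1..s}) \<le> a"
        using An by (metis card_mono finite_atLeastAtMost finite_subset inf_le1)
      ultimately show ?thesis using cardGT by simp
    next
      \<comment> \<open>Now \<open>G\<close> extends beyond \<open>s\<close>, hence contains all of
        \<open>{1..s} - B\<close>. With \<open>T\<close> this gives
        \<open>s - card (B \<inter> {1..s}) + (t - 1)\<close> elements, exactly the bound that
        \<open>less\<close> puts on the prefix of \<open>A\<close>.\<close>
      case False
      then obtain g where "g \<in> G" "\<not> g \<le> s" using Gn by fastforce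
      then have "{1..s} - B \<subseteq> G"
        using G(3) s unfolding S_def by auto
      then have sub: "({1..s} - B) \<union> T \<subseteq> (G \<union> T) \<inter> {1..s}" using TS by auto
      have "{1..s} - B = {1..s} - (B \<inter> {1..s})" by blast
      then have "card ({1..s} - B) = s - card (B \<inter> {1..s})"
        by (simp add: card_Diff_subset)
      moreover have "({1..s} - B) \<inter> T = {}" using disj \<open>{1..s} - B \<subseteq> G\<close> by blast
      ultimately have "card (({1..s} - B) \<union> T) = s - card (B \<inter> {1..s}) + (t - 1)"
        using finT T(2) by (simp add: card_Un_disjoint)
      moreover have "card (({1..s} - B) \<union> T) \<le> card ((G \<union> T) \<inter> {1..s})"
        by (rule card_mono[OF _ sub]) simp
      ultimately show ?thesis using less[OF s] by linarith
    qed
  qed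
  moreover have "G \<union> T \<in> nsets {1..n} a"
    using Gn T(1) finG finT cardGT unfolding nsets_def by auto
  ultimately have "G \<union> T \<in> \<A>" using shifted_mem_of_dominates assms(1) A by blast
  then have "t \<le> card ((G \<union> T) \<inter> B)" using assms(3) B unfolding cross_intersecting_def by blast
  moreover have "(G \<union> T) \<inter> B \<subseteq> T" using G(1) unfolding S_def by blast
  then have "card ((G \<union> T) \<inter> B) \<le> t - 1" using card_mono[OF finT] T(2) by fastforce
  ultimately show False using assms by linarith
qed

section \<open>Counting paths by reflection\<close>

text \<open>
  This is the upper bound of the reflection principle for paths of length \<open>m\<close> that reach height \<open>h\<close>.
  Splitting off the first step turns it into Pascal's rule. The size is written as \<open>h + e\<close> to avoid
  truncated subtraction in the binomial coefficient.
\<close>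
lemma card_paths_reaching_height:
  "card {A. A \<subseteq> {p<..p+m} \<and> card A = h + e \<and> (\<exists>s\<le>m. s + h \<le> 2 * card (A \<inter> {p<..p+s}))}
    \<le> m choose e"
proof (induction m arbitrary: p h e)
  case (0 p h e)
  show ?case
  proof (cases "h = 0 \<and> e = 0")
    case True
    have "card {A. A \<subseteq> {p<..p+0} \<and> card A = h + e \<and> (\<exists>s\<le>0. s + h \<le> 2 * card (A \<inter> {p<..p+s}))}
      \<le> card {{}::nat set}" by (rule card_mono) auto
    then show ?thesis using True by simp
  next
    case False
    then have "{A. A \<subseteq> {p<..p+0} \<and> card A = h + e \<and> (\<exists>s\<le>0. s + h \<le> 2 * card (A \<inter> {p<..p+s}))} = {}"
      by auto
    then show ?thesis by (simp only: card.empty)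
  qed
next
  case (Suc m p h e)
  define F where "F = (\<lambda>p m h e. {A. A \<subseteq> {p<..p+m} \<and> card A = h + e \<and>
    (\<exists>s\<le>m. s + h \<le> 2 * card (A \<inter> {p<..p+s::nat}))})"
  have fin: "finite (F p m h e)" for p m h e
    unfolding F_def by (rule finite_subset[of _ "Pow {p<..p+m}"]) auto
  have IH: "card (F p m h e) \<le> m choose e" for p h e
    using Suc.IH unfolding F_def .
  show ?case
  proof (cases h)
    \<comment> \<open>Height 0 is reached at \<open>s = 0\<close>, so only the size condition
      matters.\<close>
    case 0
    have "card (F p (Suc m) h e) \<le> card {A. A \<subseteq> {p<..p + Suc m} \<and> card A = e}"
      using 0 unfolding F_def by (intro card_mono) auto
    also have "\<dots> = Suc m choose e" by (simp add: n_subsets)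
    finally show ?thesis unfolding F_def .
  next
    case (Suc h')
    \<comment> \<open>An up step leaves \<open>h'\<close> to climb with the same \<open>e\<close>. A
      down step leaves \<open>Suc h\<close>, and the unchanged size
      \<open>h + e = Suc h + (e - 1)\<close> lowers \<open>e\<close> by one; for
      \<open>e = 0\<close> there are too few elements for this climb.\<close>
    define E where "E = (case e of 0 \<Rightarrow> {} | Suc e' \<Rightarrow> F (Suc p) m (Suc h) e')"
    have "F p (Suc m) h e \<subseteq> insert (Suc p) ` F (Suc p) m h' e \<union> E"
    proof
      fix A assume "A \<in> F p (Suc m) h e"
      then obtain s where A: "A \<subseteq> {p<..p + Suc m}" "card A = h + e"
        and s: "s \<le> Suc m" "s + h \<le> 2 * card (A \<inter> {p<..p+s})"
        unfolding F_def by auto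
      have "s \<noteq> 0" using s(2) Suc by (cases s) auto
      then obtain s' where s': "s = Suc s'" using not0_implies_Suc by blast
      have finA: "finite A" using A(1) finite_subset by blast
      let ?A = "A - {Suc p}"
      have A': "?A \<subseteq> {Suc p<..Suc p + m}"
        using A(1) by force
      show "A \<in> insert (Suc p) ` F (Suc p) m h' e \<union> E"
      proof (cases "Suc p \<in> A")
        case True
        then have "A \<inter> {p<..p+s} = insert (Suc p) (?A \<inter> {Suc p<..Suc p + s'})"
          using s' by auto
        then have "card (A \<inter> {p<..p+s}) = Suc (card (?A \<inter> {Suc p<..Suc p + s'}))"
          using finA by simp
        then have "s' + h' \<le> 2 * card (?A \<inter> {Suc p<..Suc p + s'})"
          using s(2) s' Suc by simp
        moreover have "card ?A = h' + e" using True A(2) Suc finA by simp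
        ultimately have "?A \<in> F (Suc p) m h' e" using A' s(1) s' unfolding F_def by auto
        moreover have "A = insert (Suc p) ?A" using True by blast
        ultimately show ?thesis by blast
      next
        case False
        have "{p<..p+s} = insert (Suc p) {Suc p<..Suc p + s'}" using s' by auto
        then have eq: "A \<inter> {p<..p+s} = A \<inter> {Suc p<..Suc p + s'}"
          using False by (simp only: Int_insert_right if_False)
        have hit: "s' + Suc h \<le> 2 * card (A \<inter> {Suc p<..Suc p + s'})" using s(2) s' eq by simp
        \<comment> \<open>Writing \<open>c\<close> for this count,
          \<open>s' + Suc h \<le> 2 * c\<close> and \<open>c \<le> s'\<close> give
          \<open>Suc h \<le> c \<le> h + e\<close>.\<close>
        have "card (A \<inter> {Suc p<..Suc p + s'}) \<le> card {Suc p<..Suc p + s'}"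
          "card (A \<inter> {Suc p<..Suc p + s'}) \<le> card A"
          using finA by (simp_all only: card_mono finite_greaterThanAtMost inf_le1 inf_le2)
        then have "e \<noteq> 0" using hit A(2) by simp
        then obtain e' where e': "e = Suc e'" using not0_implies_Suc by blast
        have "A \<in> F (Suc p) m (Suc h) e'"
          using A A' False hit e' s(1) s' unfolding F_def by auto
        then show ?thesis unfolding E_def e' by simp
      qed
    qed
    moreover have finE: "finite E" unfolding E_def by (simp add: fin split: nat.split)
    ultimately have "card (F p (Suc m) h e) \<le> card (insert (Suc p) ` F (Suc p) m h' e \<union> E)"
      by (intro card_mono) (auto simp: fin)
    also have "\<dots> \<le> card (insert (Suc p) ` F (Suc p) m h' e) + card E" by (rule card_Un_le)
    also have "\<dots> \<le> card (F (Suc p) m h' e) + card E" by (simp add: card_image_le fin)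
    also have "\<dots> \<le> Suc m choose e"
      using IH[of "Suc p" h' e] IH[of "Suc p" "Suc h" "e - 1"] unfolding E_def by (cases e) auto
    finally show ?thesis unfolding F_def .
  qed
qed

text \<open>The trace \<open>D\<close> fixes the path up to time \<open>j\<close>, so the sets
  differ only in the remaining \<open>n - j\<close> steps, where they must climb from height
  \<open>2 * card D - j\<close> to \<open>t\<close>. The choice of \<open>j\<close> makes the
  resulting bound at most the same binomial for every \<open>D\<close>.\<close>

lemma card_trace_class_le:
  assumes \<F>: "\<F> \<subseteq> nsets {1..n} k" and "t < r" "r \<le> k" "2 * k \<le> n" "j = 2 * r - t - 1"
    and D: "D \<subseteq> {1..j}"
    and reach: "\<And>A. A \<in> \<F> \<Longrightarrow> A \<inter> {1..j} = D \<and> (\<exists>s\<in>{j..n}. s + t \<le> 2 * card (A \<inter> {1..s}))"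
  shows "card \<F> \<le> (n - j) choose (k - r)"
proof (cases "\<F> = {}")
  case False
  define d where "d = card D"
  \<comment> \<open>The remaining climb is \<open>t + j - 2 * d\<close>, and
    \<open>t + j = 2 * r - 1\<close>. By parity, \<open>h = 0\<close> means
    \<open>r \<le> d\<close>: the path is already above \<open>t\<close> at time
    \<open>j\<close>.\<close>
  define h where "h = 2 * r - 1 - 2 * d"
  have jn: "j \<le> n" using assms by linarith
  have finD: "finite D" using D finite_subset by blast
  have props: "A - D \<subseteq> {j<..j + (n - j)} \<and> card (A - D) = k - d \<and> d \<le> k \<and> h \<le> k - d \<and>
      (\<exists>s\<le>n - j. s + h \<le> 2 * card ((A - D) \<inter> {j<..j+s}))" if AF: "A \<in> \<F>" for A
  proof -
    have A: "A \<subseteq> {1..n}" "finite A" "card A = k" using \<F> AF unfolding nsets_def by auto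
    obtain s where AD: "A \<inter> {1..j} = D" and s: "s \<in> {j..n}" "s + t \<le> 2 * card (A \<inter> {1..s})"
      using reach[OF AF] by blast
    have sub: "A - D \<subseteq> {j<..n}" using A(1) AD by force
    have "D \<subseteq> A" using AD by blast
    then have c: "card (A - D) = k - d" "d \<le> k"
      using A finD unfolding d_def by (auto simp: card_Diff_subset card_mono)
    have "A \<inter> {1..s} = D \<union> (A - D) \<inter> {j<..s}" using AD s(1) A(1) by force
    moreover have "card (D \<union> (A - D) \<inter> {j<..s}) = d + card ((A - D) \<inter> {j<..s})"
      unfolding d_def using A(2) finD by (intro card_Un_disjoint) auto
    ultimately have cs: "s + t \<le> 2 * (d + card ((A - D) \<inter> {j<..s}))" using s(2) by simp
    have hit: "s - j + h \<le> 2 * card ((A - D) \<inter> {j<..s})" if "0 < h"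
      using cs s(1) assms that unfolding h_def by auto
    have le: "card ((A - D) \<inter> {j<..s}) \<le> card {j<..s}" "card ((A - D) \<inter> {j<..s}) \<le> card (A - D)"
      using A(2) by (simp_all only: card_mono finite_greaterThanAtMost finite_Diff inf_le1 inf_le2)
    \<comment> \<open>Climbing \<open>h\<close> takes at least \<open>h\<close> elements after
      \<open>j\<close>; this keeps \<open>e\<close> below free of truncation.\<close>
    have "h \<le> k - d" using hit le c by (cases "h = 0") auto
    moreover have "\<exists>s\<le>n - j. s + h \<le> 2 * card ((A - D) \<inter> {j<..j+s})"
    proof (cases "h = 0")
      case True
      then show ?thesis by (intro exI[of _ 0]) simp
    next
      case False
      then show ?thesis using hit s(1) by (intro exI[of _ "s - j"]) auto
    qed
    ultimately show ?thesis using sub c jn by simp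
  qed
  then obtain "d \<le> k" "h \<le> k - d" using False by blast
  define e where "e = k - d - h"
  let ?P = "{A. A \<subseteq> {j<..j + (n - j)} \<and> card A = h + e \<and>
    (\<exists>s\<le>n - j. s + h \<le> 2 * card (A \<inter> {j<..j+s}))}"
  have "inj_on (\<lambda>A. A - D) \<F>"
    using reach by (intro inj_onI) blast
  then have "card \<F> = card ((\<lambda>A. A - D) ` \<F>)" by (simp add: card_image)
  also have "\<dots> \<le> card ?P"
  proof (rule card_mono)
    show "finite ?P" by (rule finite_subset[of _ "Pow {j<..j + (n - j)}"]) auto
    show "(\<lambda>A. A - D) ` \<F> \<subseteq> ?P"
    proof (rule image_subsetI)
      fix A assume "A \<in> \<F>"
      then show "A - D \<in> ?P" using props[of A] \<open>h \<le> k - d\<close> unfolding e_def by auto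
    qed
  qed
  also have "\<dots> \<le> (n - j) choose e" by (rule card_paths_reaching_height)
  \<comment> \<open>If \<open>0 < h\<close>, then \<open>d < r\<close> and
    \<open>e = k + d + 1 - 2 * r\<close>; otherwise \<open>r \<le> d\<close> and
    \<open>e = k - d\<close>. Either way \<open>e \<le> k - r\<close>, and
    \<open>2 * (k - r) \<le> n - j\<close> places both indices in the increasing half of the
    binomial row.\<close>
  also have "\<dots> \<le> (n - j) choose (k - r)"
    using assms \<open>d \<le> k\<close> \<open>h \<le> k - d\<close> unfolding e_def h_def
    by (intro binomial_mono) linarith+
  finally show ?thesis .
qed simp

section \<open>The juntas\<close>

text \<open>One low member suffices to include a trace; other members with that trace then lie in
  the junta too, whatever their paths do after \<open>j\<close>.\<close>

definition low_traces :: "nat \<Rightarrow> nat \<Rightarrow> nat \<Rightarrow> nat set set \<Rightarrow> nat set set" where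
  "low_traces n j t \<F> =
    {A \<inter> {1..j} | A. A \<in> \<F> \<and> (\<forall>s\<in>{j..n}. 2 * card (A \<inter> {1..s}) < s + t)}"

lemma card_outside_low_traces_le:
  assumes \<F>: "\<F> \<subseteq> nsets {1..n} k" and "t < r" "r \<le> k" "2 * k \<le> n" "j = 2 * r - t - 1"
  shows "card (\<F> - {F. F \<subseteq> {1..n} \<and> F \<inter> {1..j} \<in> low_traces n j t \<F>})
    \<le> 2 ^ j * ((n - j) choose (k - r))"
proof -
  define \<R> where "\<R> = \<F> - {F. F \<subseteq> {1..n} \<and> F \<inter> {1..j} \<in> low_traces n j t \<F>}"
  have "card {A\<in>\<R>. A \<inter> {1..j} = D} \<le> (n - j) choose (k - r)" if "D \<in> Pow {1..j}" for D
  proof (rule card_trace_class_le)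
    fix A assume A: "A \<in> {A\<in>\<R>. A \<inter> {1..j} = D}"
    then have "A \<in> \<F>" "A \<subseteq> {1..n}" "A \<inter> {1..j} \<notin> low_traces n j t \<F>"
      using \<F> unfolding \<R>_def nsets_def by auto
    \<comment> \<open>Otherwise \<open>A\<close> itself would witness that its trace is low.\<close>
    then have "\<exists>s\<in>{j..n}. s + t \<le> 2 * card (A \<inter> {1..s})"
      unfolding low_traces_def by (auto simp: not_less)
    then show "A \<inter> {1..j} = D \<and> (\<exists>s\<in>{j..n}. s + t \<le> 2 * card (A \<inter> {1..s}))"
      using A by blast
  next
    show "D \<subseteq> {1..j}" using that by simp
    show "{A\<in>\<R>. A \<inter> {1..j} = D} \<subseteq> nsets {1..n} k" using \<F> unfolding \<R>_def by blast
  qed (use assms in \<open>linarith+\<close>)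
  then have "(\<Sum>D\<in>Pow {1..j}. card {A\<in>\<R>. A \<inter> {1..j} = D})
      \<le> (\<Sum>D\<in>Pow {1..j}. (n - j) choose (k - r))"
    by (rule sum_mono)
  moreover have "(\<Union>D\<in>Pow {1..j}. {A\<in>\<R>. A \<inter> {1..j} = D}) = \<R>"
  proof (intro equalityI subsetI)
    fix A assume "A \<in> \<R>"
    then show "A \<in> (\<Union>D\<in>Pow {1..j}. {A\<in>\<R>. A \<inter> {1..j} = D})"
      by (intro UN_I[of "A \<inter> {1..j}"]) simp_all
  qed (elim UN_E CollectE conjE)
  then have "card \<R> \<le> (\<Sum>D\<in>Pow {1..j}. card {A\<in>\<R>. A \<inter> {1..j} = D})"
    using card_UN_le[of "Pow {1..j}" "\<lambda>D. {A\<in>\<R>. A \<inter> {1..j} = D}"]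
    by (simp only: finite_Pow_iff finite_atLeastAtMost)
  ultimately show ?thesis unfolding \<R>_def by (simp add: card_Pow)
qed

text \<open>At the time \<open>s\<close> from \<open>prefix\<close> the two heights have mean at
  least \<open>t\<close>, so they cannot both be below \<open>t\<close>. This forces
  \<open>s < j\<close>, and inclusion-exclusion within \<open>{1..s}\<close> finds \<open>t\<close>
  common elements inside the traces.\<close>

lemma cross_intersecting_low_traces:
  assumes prefix: "\<And>A B. A \<in> \<A> \<Longrightarrow> B \<in> \<B> \<Longrightarrow>
      \<exists>s\<le>n. s + t \<le> card (A \<inter> {1..s}) + card (B \<inter> {1..s})"
  shows "cross_intersecting t (low_traces n j t \<A>) (low_traces n j t \<B>)"
  unfolding cross_intersecting_def
proof (intro ballI)
  fix D D' assume "D \<in> low_traces n j t \<A>" "D' \<in> low_traces n j t \<B>"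
  then obtain A B where A: "A \<in> \<A>" "D = A \<inter> {1..j}" "\<forall>s\<in>{j..n}. 2 * card (A \<inter> {1..s}) < s + t"
    and B: "B \<in> \<B>" "D' = B \<inter> {1..j}" "\<forall>s\<in>{j..n}. 2 * card (B \<inter> {1..s}) < s + t"
    unfolding low_traces_def by blast
  obtain s where s: "s \<le> n" "s + t \<le> card (A \<inter> {1..s}) + card (B \<inter> {1..s})"
    using prefix A(1) B(1) by blast
  have "s < j"
  proof (rule ccontr)
    assume "\<not> s < j"
    then have "s \<in> {j..n}" using s(1) by simp
    then have "2 * card (A \<inter> {1..s}) < s + t" "2 * card (B \<inter> {1..s}) < s + t"
      using A(3) B(3) by blast+
    then show False using s(2) by linarith
  qed
  let ?A = "A \<inter> {1..s}" and ?B = "B \<inter> {1..s}"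
  have "card ?A + card ?B = card (?A \<union> ?B) + card (?A \<inter> ?B)" by (rule card_Un_Int) auto
  moreover have "card (?A \<union> ?B) \<le> card {1..s}" by (rule card_mono) auto
  moreover have "card (?A \<inter> ?B) \<le> card (D \<inter> D')"
    unfolding A(2) B(2) by (rule card_mono) (use \<open>s < j\<close> in auto)
  ultimately show "t \<le> card (D \<inter> D')" using s(2) by simp
qed

theorem theorem2p1:
  fixes a b r t n j :: nat and \<A> \<B> :: "nat set set"
  assumes "a \<ge> b" "b \<ge> r" "r > t" "t > 0"
    and "\<A> \<subseteq> nsets {1..n} a" "\<B> \<subseteq> nsets {1..n} b"
    and "shifted n a \<A>" "shifted n b \<B>"
    and "cross_intersecting t \<A> \<B>"
    and "j = 2 * r - t - 1"
    and "n \<ge> 2 * a"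
  shows "\<exists>\<J> \<I>.
           junta_with_center n j {1..j} \<J> \<and> junta_with_center n j {1..j} \<I> \<and>
           cross_intersecting t \<J> \<I> \<and>
           card (\<A> - \<J>) \<le> 2 ^ j * ((n - j) choose (a - r)) \<and>
           card (\<B> - \<I>) \<le> 2 ^ j * ((n - j) choose (b - r))"
proof -
  define Jt where "Jt = (\<lambda>\<F>. {F. F \<subseteq> {1..n} \<and> F \<inter> {1..j} \<in> low_traces n j t \<F>})"
  have "j \<le> n" using assms by linarith
  then have "{1..j} \<in> nsets {1..n} j" unfolding nsets_def by auto
  moreover have "low_traces n j t \<F> \<subseteq> Pow {1..j}" for \<F> unfolding low_traces_def by blast
  ultimately have junta: "junta_with_center n j {1..j} (Jt \<F>)" for \<F>
    unfolding junta_with_center_def Jt_def by blast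
  have "cross_intersecting t (low_traces n j t \<A>) (low_traces n j t \<B>)"
  proof (rule cross_intersecting_low_traces)
    fix A B assume "A \<in> \<A>" "B \<in> \<B>"
    then show "\<exists>s\<le>n. s + t \<le> card (A \<inter> {1..s}) + card (B \<inter> {1..s})"
      using assms by (intro shifted_cross_intersecting_prefix[of n a \<A> \<B> b t]) auto
  qed
  then have low: "t \<le> card ((F \<inter> {1..j}) \<inter> (F' \<inter> {1..j}))" if "F \<in> Jt \<A>" "F' \<in> Jt \<B>" for F F'
    using that unfolding cross_intersecting_def Jt_def by blast
  have "t \<le> card (F \<inter> F')" if "F \<in> Jt \<A>" "F' \<in> Jt \<B>" for F F'
  proof -
    have "finite (F \<inter> F')" using that unfolding Jt_def by (auto intro: finite_subset)
    then have "card ((F \<inter> {1..j}) \<inter> (F' \<inter> {1..j})) \<le> card (F \<inter> F')"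
      by (rule card_mono) blast
    then show ?thesis using low[OF that] by linarith
  qed
  then have "cross_intersecting t (Jt \<A>) (Jt \<B>)" unfolding cross_intersecting_def by blast
  \<comment> \<open>The same bound serves both families, because \<open>b \<le> a\<close> gives
    \<open>2 * b \<le> n\<close> as well.\<close>
  moreover have "card (\<A> - Jt \<A>) \<le> 2 ^ j * ((n - j) choose (a - r))"
    "card (\<B> - Jt \<B>) \<le> 2 ^ j * ((n - j) choose (b - r))"
    unfolding Jt_def by (rule card_outside_low_traces_le; use assms in linarith)+
  ultimately show ?thesis using junta by blast
qed

end
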